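(* Let $(\lambda^k)_{k\ge 0}$ be the (random) iterates of the SU-CD algorithm applied to $F$ with stepsize $1/L$, started from an arbitrary $\lambda^0\in\mathbb{R}^E$. Then for every $k$, $$\mathbb{E}\left[F(\lambda^{k+1})\mid \lambda^k\right]-F(\lambda^* )\;\le\;\left(1-\frac{2\sigma_A}{L\,n\,N_{\max}}\right)\left[F(\lambda^k)-F(\lambda^* )\right].$$
   Context: Setting. $\mathcal{G}=(\mathcal V,\mathcal E)$ is a finite simple undirected graph with $n=|\mathcal V|$ nodes, $E=|\mathcal E|$ edges and no isolated node; $\ell\equiv(i,j)$ means that edge $\ell$ joins nodes $i$ and $j$. $A\in\mathbb{R}^{n\times E}$ is the incidence matrix: column $\ell\equiv(i,j)$ has one entry $1$ and one entry $-1$, in rows $i$ and $j$ (the sign choice is arbitrary), and zeros elsewhere. For $i=1,\dots,n$, $f_i:\mathbb{R}\to\mathbb{R}$ is differentiable, and there are constants $M_i\ge\mu_i>0$ such that for all $x,y$: $f_i(x)+f_i'(x)(y-x)+\frac{\mu_i}{2}(y-x)^2\le f_i(y)\le f_i(x)+f_i'(x)(y-x)+\frac{M_i}{2}(y-x)^2$. $M_{\max}=\max_i M_i$, $\mu_{\min}=\min_i\mu_i$. $f_i^*(y)=\sup_{x\in\mathbb{R}}(yx-f_i(x))$ is the Fenchel conjugate, and $F:\mathbb{R}^E\to\mathbb{R}$ is $F(\lambda)=\sum_{i=1}^n f_i^*(u_i^TA\lambda)$, with $u_i$ the $i$-th standard basis vector of $\mathbb{R}^n$. $\lambda^*$ is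 a minimizer of $F$. $\nabla_\ell F=\partial F/\partial\lambda_\ell$ and $e_\ell$ is the $\ell$-th standard basis vector of $\mathbb{R}^E$. $\mathcal S_i$ is the set of edges incident to node $i$, $N_i=|\mathcal S_i|$, $N_{\max}=\max_iN_i$. Constants: $L=\gamma_{\max}/\mu_{\min}$ and $\sigma_A=\gamma_{\min}^+/M_{\max}$, where $\gamma_{\max}$ and $\gamma_{\min}^+$ are the largest and the smallest strictly positive eigenvalues of $A^TA$. ($L$ is a smoothness constant of $F$ in the Euclidean norm; $\sigma_A$ is a strong convexity constant of $F$ in the semi-norm $\|x\|_A=(x^TA^+Ax)^{1/2}$, with $A^+$ the pseudo-inverse of $A$.) SU-CD (Setwise Uniform Coordinate Descent): at each iteration $k$, independently of the past, a node $i$ is drawn uniformly from $\{1,\dots,n\}$, then an edge $\ell$ is drawn uniformly from $\mathcal S_i$, and $\lambda^{k+1}=\lambda^k-\frac1L\nabla_\ell F(\lambda^k)e_\ell$. *)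

theory Defs
  imports "HOL-Probability.Probability"
begin

text \<open>
  The nodes are the elements of a finite type and the edges are indexed by a finite type;
  \<open>ends l\<close> is the unordered pair of nodes joined by edge \<open>l\<close>, so the edge set is \<open>range ends\<close>.
  Injectivity of \<open>ends\<close> excludes parallel edges, and \<open>card (ends l) = 2\<close> excludes loops.
\<close>

definition simple_graph :: "('e \<Rightarrow> 'v set) \<Rightarrow> bool" where
  "simple_graph ends \<longleftrightarrow> inj ends \<and> (\<forall>l. card (ends l) = 2)"

definition incident_edges :: "('e \<Rightarrow> 'v set) \<Rightarrow> 'v \<Rightarrow> 'e set" where
  "incident_edges ends i = {l. i \<in> ends l}"

definition no_isolated_node :: "('e \<Rightarrow> 'v set) \<Rightarrow> bool" where
  "no_isolated_node ends \<longleftrightarrow> (\<forall>i. incident_edges ends i \<noteq> {})"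

definition max_degree :: "('e::finite \<Rightarrow> 'v::finite set) \<Rightarrow> nat" where
  "max_degree ends = Max (range (\<lambda>i. card (incident_edges ends i)))"

text \<open>A predicate rather than a function of the graph: the sign choice in each column is arbitrary.\<close>

definition incidence_matrix :: "('e \<Rightarrow> 'v set) \<Rightarrow> real ^ 'e ^ 'v \<Rightarrow> bool" where
  "incidence_matrix ends A \<longleftrightarrow>
    (\<forall>l. \<exists>i j. i \<noteq> j \<and> ends l = {i, j} \<and> A $ i $ l = 1 \<and> A $ j $ l = -1 \<and>
         (\<forall>h. h \<noteq> i \<and> h \<noteq> j \<longrightarrow> A $ h $ l = 0))"

definition eigenvalues :: "real ^ 'n ^ 'n \<Rightarrow> real set" where
  "eigenvalues B = {c. \<exists>v. v \<noteq> 0 \<and> B *v v = c *\<^sub>R v}"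

text \<open>
  The maximum and the minimum below range over finite sets, see \<open>finite_eigenvalues_gram\<close>;
  the sets are nonempty because a Gram matrix is symmetric and an incidence matrix is nonzero.
\<close>

definition gamma_max :: "real ^ 'e ^ 'v \<Rightarrow> real" where
  "gamma_max A = Max (eigenvalues (transpose A ** A))"

definition gamma_min_pos :: "real ^ 'e ^ 'v \<Rightarrow> real" where
  "gamma_min_pos A = Min {c \<in> eigenvalues (transpose A ** A). c > 0}"

lemma finite_eigenvalues_gram:
  fixes A :: "real ^ 'e ^ 'v"
  shows "finite (eigenvalues (transpose A ** A))"
proof -
  let ?B = "transpose A ** A"
  define v where "v c = (SOME v. v \<noteq> 0 \<and> ?B *v v = c *\<^sub>R v)" for c
  have v: "v c \<noteq> 0 \<and> ?B *v v c = c *\<^sub>R v c" if "c \<in> eigenvalues ?B" for c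
    proof -
    have "\<exists>v. v \<noteq> 0 \<and> ?B *v v = c *\<^sub>R v"
      using that unfolding eigenvalues_def by simp
    then show ?thesis unfolding v_def by (rule someI_ex)
  qed
  have sym: "(?B *v x) \<bullet> y = x \<bullet> (?B *v y)" for x y
  proof -
    have 1: "(?B *v z) \<bullet> w = (A *v z) \<bullet> (A *v w)" for z w
      by (simp flip: matrix_vector_mul_assoc dot_lmul_matrix)
    show ?thesis unfolding 1 by (metis 1 inner_commute)
  qed
  have orth: "v c \<bullet> v d = 0"
    if "c \<in> eigenvalues ?B" "d \<in> eigenvalues ?B" "c \<noteq> d" for c d
  proof -
    have "c * (v c \<bullet> v d) = d * (v c \<bullet> v d)"
      using sym[of "v c" "v d"] v[OF that(1)] v[OF that(2)] by simp
    then show ?thesis using that(3) by simp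
  qed
  have inj: "inj_on v (eigenvalues ?B)"
    by (rule inj_onI) (metis orth v inner_eq_zero_iff)
  have "pairwise orthogonal (v ` eigenvalues ?B)"
    by (auto simp: pairwise_def orthogonal_def) (metis orth)
  then have "independent (v ` eigenvalues ?B)"
    by (rule pairwise_orthogonal_independent) (use v in auto)
  then have "finite (v ` eigenvalues ?B)"
    by (rule independent_imp_finite)
  then show ?thesis using inj by (rule finite_imageD)
qed

text \<open>
  Differentiability is required separately: \<open>deriv\<close> is total.
\<close>

definition curvature_bounds :: "(real \<Rightarrow> real) \<Rightarrow> real \<Rightarrow> real \<Rightarrow> bool" where
  "curvature_bounds g \<mu> M \<longleftrightarrow>
    (\<forall>x y. g x + deriv g x * (y - x) + \<mu> / 2 * (y - x)\<^sup>2 \<le> g y \<and>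
           g y \<le> g x + deriv g x * (y - x) + M / 2 * (y - x)\<^sup>2)"

text \<open>
  The supremum is taken in the reals, which is meaningful only if it is finite;
  for positive lower curvature this is \<open>bdd_above_fenchel\<close>.
\<close>

definition fenchel_conjugate :: "(real \<Rightarrow> real) \<Rightarrow> real \<Rightarrow> real" where
  "fenchel_conjugate g y = (SUP x. y * x - g x)"

lemma bdd_above_fenchel:
  assumes "curvature_bounds g \<mu> M" and "\<mu> > 0"
  shows "bdd_above (range (\<lambda>x. y * x - g x))"
proof (rule bdd_aboveI2)
  fix x :: real
  let ?b = "y - deriv g 0"
  have "g 0 + deriv g 0 * (x - 0) + \<mu> / 2 * (x - 0)\<^sup>2 \<le> g x"
    using assms(1) unfolding curvature_bounds_def by blast
  moreover have "?b * x - \<mu> / 2 * x\<^sup>2 \<le> ?b\<^sup>2 / (2 * \<mu>)"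
  proof -
    have "?b\<^sup>2 / (2 * \<mu>) - (?b * x - \<mu> / 2 * x\<^sup>2) = (?b - \<mu> * x)\<^sup>2 / (2 * \<mu>)"
      using assms(2) by (simp add: field_simps power2_eq_square)
    moreover have "(?b - \<mu> * x)\<^sup>2 / (2 * \<mu>) \<ge> 0"
      using assms(2) by simp
    ultimately show ?thesis by linarith
  qed
  ultimately show "y * x - g x \<le> ?b\<^sup>2 / (2 * \<mu>) - g 0"
    by (simp add: algebra_simps)
qed

definition dual_objective ::
    "('v::finite \<Rightarrow> real \<Rightarrow> real) \<Rightarrow> real ^ 'e ^ 'v \<Rightarrow> real ^ 'e \<Rightarrow> real" where
  "dual_objective f A x = (\<Sum>i\<in>UNIV. fenchel_conjugate (f i) (axis i 1 \<bullet> (A *v x)))"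

definition partial_deriv :: "(real ^ 'e \<Rightarrow> real) \<Rightarrow> 'e \<Rightarrow> real ^ 'e \<Rightarrow> real" where
  "partial_deriv F l x = deriv (\<lambda>t. F (x + t *\<^sub>R axis l 1)) 0"

definition smoothness_const :: "real ^ 'e ^ 'v \<Rightarrow> ('v::finite \<Rightarrow> real) \<Rightarrow> real" where
  "smoothness_const A \<mu> = gamma_max A / Min (range \<mu>)"

definition strong_convexity_const :: "real ^ 'e ^ 'v \<Rightarrow> ('v::finite \<Rightarrow> real) \<Rightarrow> real" where
  "strong_convexity_const A M = gamma_min_pos A / Max (range M)"

definition setwise_uniform_pmf :: "('e \<Rightarrow> 'v set) \<Rightarrow> ('v \<times> 'e) pmf" where
  "setwise_uniform_pmf ends =
    bind_pmf (pmf_of_set UNIV) (\<lambda>i. map_pmf (Pair i) (pmf_of_set (incident_edges ends i)))"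

text \<open>
  \<open>node k\<close> and \<open>edge k\<close> are the draws of iteration \<open>k\<close>. Since the starting point is deterministic,
  mutual independence of the pairs over all iterations says that each draw is independent of the past.
\<close>

definition setwise_uniform_draws ::
    "'w measure \<Rightarrow> ('e \<Rightarrow> 'v set) \<Rightarrow> (nat \<Rightarrow> 'w \<Rightarrow> 'v) \<Rightarrow> (nat \<Rightarrow> 'w \<Rightarrow> 'e) \<Rightarrow> bool" where
  "setwise_uniform_draws P ends node edge \<longleftrightarrow>
    prob_space P \<and>
    prob_space.indep_vars P (\<lambda>_. count_space UNIV) (\<lambda>k \<omega>. (node k \<omega>, edge k \<omega>)) UNIV \<and>
    (\<forall>k. distr P (count_space UNIV) (\<lambda>\<omega>. (node k \<omega>, edge k \<omega>)) =
         measure_pmf (setwise_uniform_pmf ends))"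

primrec cd_iterate ::
    "(real ^ 'e \<Rightarrow> real) \<Rightarrow> real \<Rightarrow> real ^ 'e \<Rightarrow> (nat \<Rightarrow> 'e) \<Rightarrow> nat \<Rightarrow> real ^ 'e" where
  "cd_iterate F s x0 l 0 = x0"
| "cd_iterate F s x0 l (Suc k) =
    (let x = cd_iterate F s x0 l k in x - (s * partial_deriv F (l k) x) *\<^sub>R axis (l k) 1)"

definition cond_exp_given ::
    "'w measure \<Rightarrow> ('w \<Rightarrow> real) \<Rightarrow> ('w \<Rightarrow> 'b::topological_space) \<Rightarrow> 'w \<Rightarrow> real" where
  "cond_exp_given P Y X = real_cond_exp P (vimage_algebra (space P) X borel) Y"

end

theory Submission
  imports Defs
begin

text \<open>
  The conjugate of a function with curvature between \<open>\<mu>\<close> and \<open>M\<close> has curvature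
  between \<open>1 / M\<close> and \<open>1 / \<mu>\<close> (\<open>fenchel_conjugate_curvature\<close>). The dual objective \<open>F\<close> sums such
  conjugates at the entries of \<open>A x\<close>, so along a displacement \<open>d\<close> it lies between two quadratic models with
  second-order terms proportional to \<open>\<parallel>A d\<parallel>\<^sup>2\<close> (\<open>curvature_bounds_separable\<close>). These turn into statements
  about \<open>F\<close> on the edge space by two spectral bounds.

  From above, \<open>\<parallel>A d\<parallel>\<^sup>2 \<le> gamma_max A * \<parallel>d\<parallel>\<^sup>2\<close>, so \<open>F\<close> is smooth with constant \<open>L\<close>, and a coordinate step of
  size \<open>1 / L\<close> along edge \<open>l\<close> lowers \<open>F\<close> by at least the squared partial derivative over \<open>2 * L\<close>
  (\<open>coordinate_step_decrease\<close>). Each edge is drawn through either of its two ends, hence with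
  probability at least \<open>2 / (n * max_degree)\<close> (\<open>setwise_uniform_expectation_ge\<close>). The expected decrease is
  therefore at least \<open>\<parallel>p\<parallel>\<^sup>2 / (L * n * max_degree)\<close>, where \<open>p\<close> is the gradient.

  From below, \<open>\<parallel>A d\<parallel>\<^sup>2 \<ge> gamma_min_pos A * \<parallel>d\<parallel>\<^sup>2\<close> holds only on the orthogonal complement of \<open>ker A\<close>. That is enough:
  the gradient lies in this complement, so the part of \<open>d\<close> in \<open>ker A\<close> contributes nothing to the lower
  model, and \<open>\<parallel>p\<parallel>\<^sup>2 \<ge> 2 * \<sigma> * (F x - F y)\<close> for all \<open>x\<close> and \<open>y\<close> (\<open>gradient_dominance\<close>). Taking a minimizer
  for \<open>y\<close> gives the contraction from a fixed point \<open>x\<close> (\<open>setwise_uniform_step_contraction\<close>).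

  Finally, the current iterate depends on the past draws alone and takes finitely many values, and
  the next edge is independent of it. So conditioning on the iterate amounts to freezing it and averaging over
  the edge (\<open>cond_exp_given_independent_finite\<close>).
\<close>

section \<open>Curvature of the Fenchel conjugate\<close>

text \<open>
  The point sought is a minimizer of \<open>g w - y * w\<close>. The lower curvature bound at \<open>0\<close> makes this
  function coercive, so it can be minimized on a compact interval.
\<close>

lemma curvature_bounds_deriv_surj:
  fixes g :: "real \<Rightarrow> real"
  assumes curv: "curvature_bounds g m K" and "m > 0" and diff: "\<And>x. g differentiable (at x)"
  obtains x where "deriv g x = y"
proof -
  define h where "h w = g w - y * w" for w
  \<comment> \<open>Outside \<open>[-R, R]\<close> the quadratic term at \<open>0\<close> outweighs the linear one, so the value exceeds \<open>h 0\<close>.\<close>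
  define R where "R = 2 * \<bar>deriv g 0 - y\<bar> / m"
  have "R \<ge> 0" using \<open>m > 0\<close> by (simp add: R_def)
  have cont: "continuous_on {-R..R} h"
    unfolding h_def
    by (intro continuous_intros differentiable_imp_continuous_on differentiable_at_imp_differentiable_on diff)
  obtain x where x: "x \<in> {-R..R}" and xmin: "\<And>w. w \<in> {-R..R} \<Longrightarrow> h x \<le> h w"
    using continuous_attains_inf[OF compact_Icc _ cont] \<open>R \<ge> 0\<close> by force
  have min: "h x \<le> h w" for w
  proof (cases "\<bar>w\<bar> \<le> R")
    case True
    then show ?thesis by (intro xmin) auto
  next
    case False
    have "g 0 + deriv g 0 * (w - 0) + m / 2 * (w - 0)\<^sup>2 \<le> g w"
      using curv unfolding curvature_bounds_def by blast
    moreover have "\<bar>(deriv g 0 - y) * w\<bar> \<le> m / 2 * w\<^sup>2"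
    proof -
      have "\<bar>deriv g 0 - y\<bar> = m / 2 * R" using \<open>m > 0\<close> by (simp add: R_def)
      then have "\<bar>(deriv g 0 - y) * w\<bar> = m / 2 * R * \<bar>w\<bar>" by (simp add: abs_mult)
      also have "\<dots> \<le> m / 2 * \<bar>w\<bar> * \<bar>w\<bar>"
        using False \<open>m > 0\<close> by (intro mult_right_mono) auto
      finally show ?thesis by (simp add: power2_eq_square)
    qed
    ultimately have "h 0 \<le> h w" using abs_ge_minus_self[of "(deriv g 0 - y) * w"]
      by (simp add: h_def left_diff_distrib)
    moreover have "h x \<le> h 0" using \<open>R \<ge> 0\<close> by (intro xmin) auto
    ultimately show ?thesis by linarith
  qed
  have "(g has_field_derivative deriv g x) (at x)"
    using diff[of x] by (simp add: DERIV_deriv_iff_real_differentiable)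
  then have "(h has_real_derivative deriv g x - y) (at x)"
    unfolding h_def by (auto intro!: derivative_eq_intros)
  then have "deriv g x - y = 0"
    by (rule DERIV_local_min[of _ _ _ 1]) (auto intro: min)
  then show ?thesis by (intro that[of x]) simp
qed

lemma fenchel_conjugate_eq:
  assumes "curvature_bounds g m K" "m > 0" "deriv g x = y"
  shows "fenchel_conjugate g y = y * x - g x"
  unfolding fenchel_conjugate_def
proof (rule cSup_eq_maximum)
  show "z \<le> y * x - g x" if z_range: "z \<in> range (\<lambda>x. y * x - g x)" for z
  proof -
    obtain w where z: "z = y * w - g w" using z_range by auto
    have "g x + y * (w - x) + m / 2 * (w - x)\<^sup>2 \<le> g w"
      using assms unfolding curvature_bounds_def by blast
    moreover have "m / 2 * (w - x)\<^sup>2 \<ge> 0" using \<open>m > 0\<close> by simp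
    ultimately show ?thesis unfolding z by (simp add: algebra_simps)
  qed
qed auto

text \<open>
  This supplies the differentiability of a conjugate, whose definition as a supremum gives only
  inequalities.
\<close>

lemma quadratic_sandwich_imp_DERIV:
  fixes h :: "real \<Rightarrow> real"
  assumes "\<And>z. h y + D * (z - y) + a * (z - y)\<^sup>2 \<le> h z"
    and "\<And>z. h z \<le> h y + D * (z - y) + b * (z - y)\<^sup>2"
  shows "(h has_field_derivative D) (at y)"
  unfolding DERIV_def
proof (rule LIM_I)
  fix r :: real assume "r > 0"
  define C where "C = \<bar>a\<bar> + \<bar>b\<bar> + 1"
  have "C > 0" by (simp add: C_def add_nonneg_pos)
  have "norm ((h (y + t) - h y) / t - D) < r" if "t \<noteq> 0" "norm (t - 0) < r / C" for t
  proof -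
    have "\<bar>h (y + t) - h y - D * t\<bar> \<le> C * t\<^sup>2"
    proof -
      have "a * t\<^sup>2 \<ge> - C * t\<^sup>2" "b * t\<^sup>2 \<le> C * t\<^sup>2"
        by (intro mult_right_mono; simp add: C_def)+
      then show ?thesis using assms[of "y + t"] by (simp add: abs_le_iff)
    qed
    then have "\<bar>h (y + t) - h y - D * t\<bar> / \<bar>t\<bar> \<le> C * \<bar>t\<bar>"
      using that(1) by (simp add: divide_le_eq power2_eq_square mult.assoc)
    moreover have "(h (y + t) - h y) / t - D = (h (y + t) - h y - D * t) / t"
      using that(1) by (simp add: field_simps)
    moreover have "C * \<bar>t\<bar> < r" using that(2) \<open>C > 0\<close> by (simp add: field_simps)
    ultimately show ?thesis by simp
  qed
  then show "\<exists>s>0. \<forall>t. t \<noteq> 0 \<and> norm (t - 0) < s \<longrightarrow> norm ((h (y + t) - h y) / t - D) < r"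
    using \<open>r > 0\<close> \<open>C > 0\<close> by (intro exI[of _ "r / C"]) simp
qed

text \<open>
  Conjugation reverses order and turns a quadratic of curvature \<open>c\<close> into one of curvature \<open>1 / c\<close>;
  hence an upper curvature bound of \<open>g\<close> becomes a lower one of its conjugate, and vice versa.
  The slope at \<open>y\<close> is the maximizer \<open>x\<close> in the supremum that defines the conjugate at \<open>y\<close>.
\<close>

lemma fenchel_conjugate_sandwich:
  fixes g :: "real \<Rightarrow> real"
  assumes curv: "curvature_bounds g m K" and "m > 0" "m \<le> K" and "\<And>x. g differentiable (at x)"
    and x: "deriv g x = y"
  shows "fenchel_conjugate g y + x * (z - y) + 1 / K / 2 * (z - y)\<^sup>2 \<le> fenchel_conjugate g z"
    and "fenchel_conjugate g z \<le> fenchel_conjugate g y + x * (z - y) + 1 / m / 2 * (z - y)\<^sup>2"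
proof -
  have "K > 0" using assms(2,3) by linarith
  have gy: "fenchel_conjugate g y = y * x - g x"
    by (rule fenchel_conjugate_eq[OF curv \<open>m > 0\<close> x])
  \<comment> \<open>The maximizer of \<open>z * w\<close> minus the upper quadratic model of \<open>g\<close> at \<open>x\<close>.\<close>
  define w where "w = x + (z - y) / K"
  have "g w \<le> g x + y * (w - x) + K / 2 * (w - x)\<^sup>2"
    using curv x unfolding curvature_bounds_def by blast
  moreover have "z * w - g w \<le> fenchel_conjugate g z"
    unfolding fenchel_conjugate_def
    by (rule cSUP_upper[OF _ bdd_above_fenchel[OF curv \<open>m > 0\<close>]]) simp
  moreover have "K / 2 * (w - x)\<^sup>2 = 1 / K / 2 * (z - y)\<^sup>2"
    using \<open>K > 0\<close> by (simp add: w_def field_simps power2_eq_square)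
  moreover have "(z - y) * (w - x) = 2 * (1 / K / 2 * (z - y)\<^sup>2)"
    using \<open>K > 0\<close> by (simp add: w_def field_simps power2_eq_square)
  ultimately show "fenchel_conjugate g y + x * (z - y) + 1 / K / 2 * (z - y)\<^sup>2 \<le> fenchel_conjugate g z"
    unfolding gy by (simp add: algebra_simps)
  obtain v where v: "deriv g v = z"
    using curvature_bounds_deriv_surj assms by blast
  have "g x + y * (v - x) + m / 2 * (v - x)\<^sup>2 \<le> g v"
    using curv x unfolding curvature_bounds_def by blast
  moreover have "(z - y) * (v - x) \<le> m / 2 * (v - x)\<^sup>2 + 1 / m / 2 * (z - y)\<^sup>2"
  proof -
    \<comment> \<open>Young's inequality, by completing the square.\<close>
    have "m / 2 * (v - x)\<^sup>2 + 1 / m / 2 * (z - y)\<^sup>2 - (z - y) * (v - x) = (m * (v - x) - (z - y))\<^sup>2 / (2 * m)"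
      using \<open>m > 0\<close> by (simp add: field_simps power2_eq_square)
    moreover have "\<dots> \<ge> 0" using \<open>m > 0\<close> by simp
    ultimately show ?thesis by linarith
  qed
  ultimately show "fenchel_conjugate g z \<le> fenchel_conjugate g y + x * (z - y) + 1 / m / 2 * (z - y)\<^sup>2"
    unfolding gy fenchel_conjugate_eq[OF curv \<open>m > 0\<close> v] by (simp add: algebra_simps)
qed

lemma fenchel_conjugate_curvature:
  fixes g :: "real \<Rightarrow> real"
  assumes "curvature_bounds g m K" "m > 0" "m \<le> K" "\<And>x. g differentiable (at x)"
  shows "curvature_bounds (fenchel_conjugate g) (1 / K) (1 / m)"
    and "fenchel_conjugate g differentiable (at y)"
proof -
  note sandwich = fenchel_conjugate_sandwich[OF assms]
  have D: "(fenchel_conjugate g has_field_derivative x) (at y)" if "deriv g x = y" for x y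
    using sandwich[OF that] by (rule quadratic_sandwich_imp_DERIV)
  have ex: "\<exists>x. deriv g x = y" for y
    using curvature_bounds_deriv_surj assms by blast
  show "fenchel_conjugate g differentiable (at y)"
    using ex D real_differentiable_def by blast
  show "curvature_bounds (fenchel_conjugate g) (1 / K) (1 / m)"
    unfolding curvature_bounds_def using ex sandwich DERIV_imp_deriv[OF D] by metis
qed

section \<open>Extreme eigenvalues of a Gram matrix\<close>

text \<open>
  A minimizer \<open>v\<close> of the Rayleigh quotient on the unit sphere of \<open>S\<close> is an eigenvector: if the residual
  \<open>w = T v - c v\<close> were nonzero, a small step from \<open>v\<close> against \<open>w\<close>, which stays in \<open>S\<close> by invariance,
  would lower the quotient. Working in a subspace is what gives access to the least positive
  eigenvalue of a singular Gram matrix; applying the result to the negated operator gives the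
  greatest eigenvalue.
\<close>

lemma self_adjoint_least_eigenvalue:
  fixes T :: "'a::euclidean_space \<Rightarrow> 'a"
  assumes lin: "linear T" and adj: "\<And>x y. T x \<bullet> y = x \<bullet> T y"
    and S: "subspace S" "S \<noteq> {0}" and inv: "\<And>x. x \<in> S \<Longrightarrow> T x \<in> S"
  obtains c v where "v \<in> S" "v \<noteq> 0" "T v = c *\<^sub>R v" "\<And>x. x \<in> S \<Longrightarrow> c * (norm x)\<^sup>2 \<le> x \<bullet> T x"
proof -
  interpret linear T by (rule lin)
  have "compact (S \<inter> sphere 0 1)"
    by (rule closed_Int_compact[OF closed_subspace[OF S(1)] compact_sphere])
  moreover obtain u where "u \<in> S" "u \<noteq> 0" using S subspace_0 by blast
  then have "u /\<^sub>R norm u \<in> S \<inter> sphere 0 1" using S(1) by (simp add: subspace_scale)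
  moreover have "continuous_on (S \<inter> sphere 0 1) (\<lambda>x. x \<bullet> T x)"
    by (intro continuous_intros linear_continuous_on linear_conv_bounded_linear[THEN iffD1] lin)
  ultimately obtain v where v: "v \<in> S \<inter> sphere 0 1"
    and vmin: "\<And>x. x \<in> S \<inter> sphere 0 1 \<Longrightarrow> v \<bullet> T v \<le> x \<bullet> T x"
    using continuous_attains_inf[of "S \<inter> sphere 0 1" "\<lambda>x. x \<bullet> T x"] by blast
  define c where "c = v \<bullet> T v"
  have low: "c * (norm x)\<^sup>2 \<le> x \<bullet> T x" if "x \<in> S" for x
  proof (cases "x = 0")
    case False
    have "c \<le> (x /\<^sub>R norm x) \<bullet> T (x /\<^sub>R norm x)"
      unfolding c_def using that False S(1) by (intro vmin) (simp add: subspace_scale)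
    also have "\<dots> = (x \<bullet> T x) / (norm x)\<^sup>2"
      by (simp add: scale power2_eq_square divide_simps)
    finally show ?thesis using False by (simp add: field_simps)
  qed (simp add: zero)
  define w where "w = T v - c *\<^sub>R v"
  have wS: "w \<in> S" unfolding w_def using v S(1) inv by (simp add: subspace_diff subspace_scale)
  define b where "b = w \<bullet> T w - c * (norm w)\<^sup>2"
  have "b \<ge> 0" using low[OF wS] by (simp add: b_def)
  have pos: "0 \<le> 2 * t * (norm w)\<^sup>2 + t\<^sup>2 * b" for t
  proof -
    let ?x = "v + t *\<^sub>R w"
    have "?x \<in> S" using v wS S(1) by (simp add: subspace_add subspace_scale)
    have vv: "v \<bullet> v = 1" using v by (simp add: dot_square_norm)
    have "?x \<bullet> T ?x - c * (norm ?x)\<^sup>2 = 2 * t * (w \<bullet> T v - c * (w \<bullet> v)) + t\<^sup>2 * b"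
      using adj[of v w] vv
      by (simp add: add scale b_def c_def power2_norm_eq_inner power2_eq_square[of t] inner_simps inner_commute algebra_simps)
    also have "w \<bullet> T v - c * (w \<bullet> v) = (norm w)\<^sup>2"
      unfolding power2_norm_eq_inner by (subst (4) w_def) (simp add: inner_simps)
    finally show ?thesis using low[OF \<open>?x \<in> S\<close>] by linarith
  qed
  have "w = 0"
  proof (rule ccontr)
    assume "w \<noteq> 0"
    define a where "a = (norm w)\<^sup>2"
    have "a > 0" using \<open>w \<noteq> 0\<close> by (simp add: a_def)
    \<comment> \<open>The step length that makes the first-order decrease dominate; \<open>b + 1\<close> instead of \<open>b\<close> covers \<open>b = 0\<close>.\<close>
    have "2 * (- a / (b + 1)) * a + (- a / (b + 1))\<^sup>2 * b = - (a / (b + 1))\<^sup>2 * (b + 2)"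
      using \<open>b \<ge> 0\<close> by (simp add: divide_simps power2_eq_square) (simp add: algebra_simps)
    moreover have "(a / (b + 1))\<^sup>2 * (b + 2) > 0" using \<open>a > 0\<close> \<open>b \<ge> 0\<close> by simp
    ultimately show False using pos[of "- a / (b + 1)"] by (simp add: a_def)
  qed
  then have "T v = c *\<^sub>R v" by (simp add: w_def)
  then show thesis using v low by (intro that[of v c]) auto
qed

lemma gram_inner:
  fixes A :: "real ^ 'e ^ 'v"
  shows "((transpose A ** A) *v x) \<bullet> y = (A *v x) \<bullet> (A *v y)"
  by (simp flip: matrix_vector_mul_assoc dot_lmul_matrix)

lemma norm_mult_le_gamma_max:
  fixes A :: "real ^ 'e ^ 'v"
  shows "(norm (A *v x))\<^sup>2 \<le> gamma_max A * (norm x)\<^sup>2"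
proof -
  let ?T = "\<lambda>x. - ((transpose A ** A) *v x)"
  have "linear ?T" by (intro linear_compose_neg matrix_vector_mul_linear)
  moreover have "?T x \<bullet> y = x \<bullet> ?T y" for x y
    by (metis gram_inner inner_commute inner_minus_left)
  moreover have "(UNIV :: (real ^ 'e) set) \<noteq> {0}"
    using axis_eq_0_iff[of undefined "1::real"] by blast
  ultimately obtain c v where v: "v \<noteq> 0" "?T v = c *\<^sub>R v"
    and c: "\<And>x. c * (norm x)\<^sup>2 \<le> x \<bullet> ?T x"
    using self_adjoint_least_eigenvalue[of ?T UNIV] by (metis subspace_UNIV UNIV_I)
  have "(transpose A ** A) *v v = (- c) *\<^sub>R v" using v(2) by (metis minus_equation_iff scaleR_minus_left)
  then have "- c \<in> eigenvalues (transpose A ** A)"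
    unfolding eigenvalues_def using v(1) by auto
  then have "- c \<le> gamma_max A"
    unfolding gamma_max_def by (rule Max_ge[OF finite_eigenvalues_gram])
  moreover have "(norm (A *v x))\<^sup>2 \<le> - c * (norm x)\<^sup>2"
    using c[of x] gram_inner[of A x x] by (simp add: power2_norm_eq_inner inner_commute)
  moreover have "- c * (norm x)\<^sup>2 \<le> gamma_max A * (norm x)\<^sup>2"
    using calculation(1) by (intro mult_right_mono) auto
  ultimately show ?thesis by linarith
qed

text \<open>
  The orthogonal complement of \<open>ker A\<close> is invariant under the Gram matrix, and the least eigenvalue there
  is positive because a vector of the complement that \<open>A\<close> kills is orthogonal to itself.
\<close>

lemma gamma_min_pos_le_norm_mult:
  fixes A :: "real ^ 'e ^ 'v"
  assumes "A \<noteq> 0"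
  shows "gamma_min_pos A > 0"
    and "(\<And>w. A *v w = 0 \<Longrightarrow> x \<bullet> w = 0) \<Longrightarrow> gamma_min_pos A * (norm x)\<^sup>2 \<le> (norm (A *v x))\<^sup>2"
proof -
  let ?T = "\<lambda>x. (transpose A ** A) *v x"
  define S where "S = {x. \<forall>w. A *v w = 0 \<longrightarrow> x \<bullet> w = 0}"
  have sub: "subspace S" unfolding S_def subspace_def by (auto simp: inner_simps)
  obtain w0 where w0: "A *v w0 \<noteq> 0"
    using assms by (metis matrix_eq matrix_vector_mult_0)
  have inv: "?T x \<in> S" for x by (simp add: S_def gram_inner)
  have "?T w0 \<noteq> 0" using gram_inner[of A w0 w0] w0 by auto
  then have "S \<noteq> {0}" using inv by blast
  moreover have "linear ?T" by (rule matrix_vector_mul_linear)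
  moreover have "?T x \<bullet> y = x \<bullet> ?T y" for x y
    by (metis gram_inner inner_commute)
  ultimately obtain c v where v: "v \<in> S" "v \<noteq> 0" "?T v = c *\<^sub>R v"
    and c: "\<And>x. x \<in> S \<Longrightarrow> c * (norm x)\<^sup>2 \<le> x \<bullet> ?T x"
    using self_adjoint_least_eigenvalue[of ?T S] sub inv by metis
  have vv: "c * (norm v)\<^sup>2 = (norm (A *v v))\<^sup>2"
    using gram_inner[of A v v] v(3) by (simp add: power2_norm_eq_inner)
  have "A *v v \<noteq> 0" using v(1,2) unfolding S_def by force
  then have "c > 0"
    using vv v(2) by (metis not_square_less_zero power2_eq_square norm_eq_zero zero_less_mult_pos2 zero_less_power2)
  let ?E = "{c \<in> eigenvalues (transpose A ** A). c > 0}"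
  have E: "finite ?E" "c \<in> ?E"
    using finite_eigenvalues_gram[of A] v(2,3) \<open>c > 0\<close> by (simp, auto simp: eigenvalues_def)
  show "gamma_min_pos A > 0"
    unfolding gamma_min_pos_def using Min_in[OF E(1)] E(2) by blast
  show "gamma_min_pos A * (norm x)\<^sup>2 \<le> (norm (A *v x))\<^sup>2" if "\<And>w. A *v w = 0 \<Longrightarrow> x \<bullet> w = 0"
  proof -
    have "gamma_min_pos A \<le> c" unfolding gamma_min_pos_def by (rule Min_le[OF E])
    then have "gamma_min_pos A * (norm x)\<^sup>2 \<le> c * (norm x)\<^sup>2" by (intro mult_right_mono) auto
    also have "\<dots> \<le> x \<bullet> ?T x" using that by (intro c) (simp add: S_def)
    also have "\<dots> = (norm (A *v x))\<^sup>2"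
      using gram_inner[of A x x] by (simp add: power2_norm_eq_inner inner_commute)
    finally show ?thesis .
  qed
qed

section \<open>Smoothness and gradient dominance\<close>

text \<open>
  The gradient has the form \<open>transpose A *v _\<close>, so it is orthogonal to \<open>ker A\<close>; the bound
  \<open>gradient_dominance\<close> rests on this.
\<close>

lemma partial_deriv_separable:
  fixes A :: "real ^ 'e ^ 'v::finite"
  assumes "\<And>i x. h i differentiable (at x)"
  shows "partial_deriv (\<lambda>x. \<Sum>i\<in>UNIV. h i ((A *v x) $ i)) l x
    = (transpose A *v (\<chi> i. deriv (h i) ((A *v x) $ i))) $ l"
proof -
  have line: "(A *v (x + t *\<^sub>R axis l 1)) $ i = (A *v x) $ i + t * A $ i $ l" for t i
    by (simp add: matrix_vector_right_distrib matrix_vector_mult_scaleR matrix_vector_mult_basis column_def)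
  have "((\<lambda>t. h i ((A *v x) $ i + t * A $ i $ l)) has_field_derivative
      deriv (h i) ((A *v x) $ i) * A $ i $ l) (at 0)" for i
  proof (rule DERIV_chain2[where g = "\<lambda>t. (A *v x) $ i + t * A $ i $ l"])
    show "(h i has_field_derivative deriv (h i) ((A *v x) $ i)) (at ((A *v x) $ i + 0 * A $ i $ l))"
      using assms by (simp add: DERIV_deriv_iff_real_differentiable)
    show "((\<lambda>t. (A *v x) $ i + t * A $ i $ l) has_field_derivative A $ i $ l) (at 0)"
      by (auto intro!: derivative_eq_intros)
  qed
  then have "((\<lambda>t. \<Sum>i\<in>UNIV. h i ((A *v x) $ i + t * A $ i $ l)) has_field_derivative
      (\<Sum>i\<in>UNIV. deriv (h i) ((A *v x) $ i) * A $ i $ l)) (at 0)"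
    by (intro DERIV_sum)
  from DERIV_imp_deriv[OF this] show ?thesis
    unfolding partial_deriv_def line by (simp add: matrix_vector_mult_def transpose_def mult.commute)
qed

lemma curvature_bounds_separable:
  fixes A :: "real ^ 'e ^ 'v::finite"
  assumes "\<And>i. curvature_bounds (h i) (m i) (K i)" "\<And>i. m0 \<le> m i" "\<And>i. K i \<le> K0"
  defines "\<Phi> \<equiv> \<lambda>x. \<Sum>i\<in>UNIV. h i ((A *v x) $ i)"
    and "p \<equiv> \<lambda>x. transpose A *v (\<chi> i. deriv (h i) ((A *v x) $ i))"
  shows "\<Phi> x + p x \<bullet> d + m0 / 2 * (norm (A *v d))\<^sup>2 \<le> \<Phi> (x + d)"
    and "\<Phi> (x + d) \<le> \<Phi> x + p x \<bullet> d + K0 / 2 * (norm (A *v d))\<^sup>2"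
proof -
  let ?u = "A *v x" and ?e = "A *v d"
  have quad: "\<Phi> x + p x \<bullet> d + c / 2 * (norm ?e)\<^sup>2
      = (\<Sum>i\<in>UNIV. h i (?u $ i) + deriv (h i) (?u $ i) * ?e $ i + c / 2 * (?e $ i)\<^sup>2)" for c
  proof -
    have "p x \<bullet> d = (\<chi> i. deriv (h i) (?u $ i)) \<bullet> ?e"
      unfolding p_def by (simp add: dot_lmul_matrix flip: vector_transpose_matrix)
    also have "\<dots> = (\<Sum>i\<in>UNIV. deriv (h i) (?u $ i) * ?e $ i)"
      by (simp add: inner_vec_def)
    finally have "p x \<bullet> d = \<dots>" .
    moreover have "(norm ?e)\<^sup>2 = (\<Sum>i\<in>UNIV. (?e $ i)\<^sup>2)"
      unfolding power2_norm_eq_inner by (simp add: inner_vec_def power2_eq_square)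
    ultimately show ?thesis
      by (simp add: \<Phi>_def sum.distrib sum_distrib_left)
  qed
  have step: "\<Phi> (x + d) = (\<Sum>i\<in>UNIV. h i (?u $ i + ?e $ i))"
    by (simp add: \<Phi>_def matrix_vector_right_distrib)
  have curv: "h i (?u $ i) + deriv (h i) (?u $ i) * ?e $ i + m i / 2 * (?e $ i)\<^sup>2 \<le> h i (?u $ i + ?e $ i)"
    "h i (?u $ i + ?e $ i) \<le> h i (?u $ i) + deriv (h i) (?u $ i) * ?e $ i + K i / 2 * (?e $ i)\<^sup>2" for i
    using assms(1)[of i] unfolding curvature_bounds_def by (metis add_diff_cancel_left')+
  have "m0 / 2 * (?e $ i)\<^sup>2 \<le> m i / 2 * (?e $ i)\<^sup>2" "K i / 2 * (?e $ i)\<^sup>2 \<le> K0 / 2 * (?e $ i)\<^sup>2" for i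
    using assms(2,3)[of i] by (intro mult_right_mono; simp)+
  note coef = this
  show "\<Phi> x + p x \<bullet> d + m0 / 2 * (norm (A *v d))\<^sup>2 \<le> \<Phi> (x + d)"
    unfolding quad step by (rule sum_mono) (use curv(1) coef(1) in \<open>smt (verit)\<close>)
  show "\<Phi> (x + d) \<le> \<Phi> x + p x \<bullet> d + K0 / 2 * (norm (A *v d))\<^sup>2"
    unfolding quad step by (rule sum_mono) (use curv(2) coef(2) in \<open>smt (verit)\<close>)
qed

lemma coordinate_step_decrease:
  fixes F :: "real ^ 'e \<Rightarrow> real"
  assumes "L > 0" and "p $ l = partial_deriv F l x"
    and smooth: "\<And>d. F (x + d) \<le> F x + p \<bullet> d + L / 2 * (norm d)\<^sup>2"
  shows "F (x - (1 / L * partial_deriv F l x) *\<^sub>R axis l 1) \<le> F x - (p $ l)\<^sup>2 / (2 * L)"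
proof -
  have "F (x - (1 / L * p $ l) *\<^sub>R axis l 1)
      \<le> F x - 1 / L * p $ l * p $ l + L / 2 * (1 / L * p $ l)\<^sup>2"
    using smooth[of "- ((1 / L * p $ l) *\<^sub>R axis l 1)"]
    by (simp add: inner_axis power_mult_distrib power_divide)
  also have "\<dots> = F x - (p $ l)\<^sup>2 / (2 * L)"
    using \<open>L > 0\<close> by (simp add: field_simps power2_eq_square)
  finally show ?thesis by (simp add: assms(2))
qed

text \<open>
  The quadratic lower bound controls only \<open>A *v d\<close>, so it says nothing about the part of \<open>d\<close> in
  \<open>ker A\<close>. But the gradient is orthogonal to \<open>ker A\<close>, so that part can be dropped, and on the
  remaining part \<open>z\<close> the bound is strongly convex with modulus \<open>gamma_min_pos A / K\<close>. Minimizing over \<open>z\<close>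
  gives the Polyak-Lojasiewicz inequality.
\<close>

lemma gradient_dominance:
  fixes A :: "real ^ 'e ^ 'v"
  assumes "A \<noteq> 0" "K > 0"
    and lower: "a + (transpose A *v h) \<bullet> d + 1 / K / 2 * (norm (A *v d))\<^sup>2 \<le> b"
  shows "2 * (gamma_min_pos A / K) * (a - b) \<le> (norm (transpose A *v h))\<^sup>2"
proof -
  define p where "p = transpose A *v h"
  define s where "s = gamma_min_pos A / K"
  have "s > 0" unfolding s_def using gamma_min_pos_le_norm_mult(1)[OF assms(1)] assms(2) by simp
  have ker: "span {w. A *v w = 0} = {w. A *v w = 0}"
    by (intro span_eq_iff[THEN iffD2]) (auto simp: subspace_def matrix_vector_right_distrib matrix_vector_mult_scaleR)
  obtain y z where y: "A *v y = 0" and z: "\<And>w. A *v w = 0 \<Longrightarrow> z \<bullet> w = 0" and d: "d = y + z"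
    using orthogonal_subspace_decomp_exists[of "{w. A *v w = 0}" d] unfolding ker orthogonal_def by auto
  have "A *v d = A *v z" using y by (simp add: d matrix_vector_right_distrib)
  have "p \<bullet> d = h \<bullet> (A *v d)" unfolding p_def by (simp add: dot_lmul_matrix flip: vector_transpose_matrix)
  also have "\<dots> = p \<bullet> z" unfolding p_def \<open>A *v d = A *v z\<close> by (simp add: dot_lmul_matrix flip: vector_transpose_matrix)
  finally have pd: "p \<bullet> d = p \<bullet> z" .
  have "gamma_min_pos A * (norm z)\<^sup>2 \<le> (norm (A *v d))\<^sup>2"
    unfolding \<open>A *v d = A *v z\<close> using z by (rule gamma_min_pos_le_norm_mult(2)[OF assms(1)])
  then have "s / 2 * (norm z)\<^sup>2 \<le> 1 / K / 2 * (norm (A *v d))\<^sup>2"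
    using \<open>K > 0\<close> by (simp add: s_def divide_simps)
  then have "a - b \<le> - (p \<bullet> z) - s / 2 * (norm z)\<^sup>2"
    using lower pd by (simp add: p_def)
  then have "2 * s * (a - b) \<le> 2 * s * (- (p \<bullet> z) - s / 2 * (norm z)\<^sup>2)"
    using \<open>s > 0\<close> by (intro mult_left_mono) auto
  also have "\<dots> = (norm p)\<^sup>2 - (norm (p + s *\<^sub>R z))\<^sup>2"
    by (simp add: power2_norm_eq_inner inner_simps inner_commute algebra_simps power2_eq_square[of s])
  also have "\<dots> \<le> (norm p)\<^sup>2" by simp
  finally show ?thesis by (simp add: p_def s_def)
qed

section \<open>Averaging over the drawn edge\<close>

text \<open>
  Summing over nodes and then over their incident edges counts every edge twice, once for each end,
  and each time with probability \<open>1 / (n * degree)\<close>, at least \<open>1 / (n * max_degree)\<close>.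
\<close>

lemma setwise_uniform_expectation_ge:
  fixes ends :: "'e::finite \<Rightarrow> 'v::finite set"
  assumes "simple_graph ends" "no_isolated_node ends" and w: "\<And>l. 0 \<le> (w l :: real)"
  shows "2 / (real CARD('v) * real (max_degree ends)) * (\<Sum>l\<in>UNIV. w l)
    \<le> measure_pmf.expectation (setwise_uniform_pmf ends) (\<lambda>z. w (snd z))"
proof -
  let ?N = "\<lambda>i. card (incident_edges ends i)"
  have N: "incident_edges ends i \<noteq> {}" "0 < ?N i" "?N i \<le> max_degree ends" for i
    using assms(2) by (auto simp: no_isolated_node_def max_degree_def card_gt_0_iff)
  have "(\<Sum>i\<in>UNIV. \<Sum>l\<in>incident_edges ends i. w l) = (\<Sum>l\<in>UNIV. \<Sum>i | i \<in> ends l. w l)"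
    unfolding incident_edges_def using sum.swap_restrict[of UNIV UNIV "\<lambda>i l. w l" "\<lambda>i l. i \<in> ends l"] by simp
  also have "\<dots> = 2 * (\<Sum>l\<in>UNIV. w l)"
    using assms(1) by (simp add: simple_graph_def sum_distrib_left)
  finally have "2 / (real CARD('v) * real (max_degree ends)) * (\<Sum>l\<in>UNIV. w l)
      = (\<Sum>i\<in>UNIV. (\<Sum>l\<in>incident_edges ends i. w l) / real (max_degree ends) / real CARD('v))"
    by (simp add: sum_divide_distrib[symmetric])
  also have "\<dots> \<le> (\<Sum>i\<in>UNIV. (\<Sum>l\<in>incident_edges ends i. w l) / real (?N i) / real CARD('v))"
    by (intro sum_mono divide_right_mono divide_left_mono sum_nonneg w)
      (use N less_le_trans[OF N(2,3)] in auto)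
  also have "\<dots> = measure_pmf.expectation (setwise_uniform_pmf ends) (\<lambda>z. w (snd z))"
    unfolding setwise_uniform_pmf_def
    by (subst pmf_expectation_bind_pmf_of_set) (simp_all add: integral_pmf_of_set N divide_inverse mult.commute)
  finally show ?thesis .
qed

section \<open>Conditioning on the current iterate\<close>

text \<open>
  Conditioning on \<open>X\<close> freezes its value and leaves the independent variable \<open>Z\<close> to be averaged out.
  As \<open>X\<close> takes finitely many values, the integrals split over the events that \<open>X\<close> equals \<open>r\<close>, and
  every function of \<open>X\<close> is measurable for the generated algebra. Independence is phrased through real functions of the two variables
  because \<open>indep_var\<close> requires both variables to have the same type.
\<close>

lemma (in prob_space) cond_exp_given_independent_finite:
  fixes X :: "'a \<Rightarrow> 'b::t1_space" and Z :: "'a \<Rightarrow> 'c::finite" and H :: "'b \<Rightarrow> 'c \<Rightarrow> real"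
  assumes X[measurable]: "X \<in> measurable M borel" and Z[measurable]: "Z \<in> measurable M (count_space UNIV)"
    and indep: "\<And>B h. B \<in> sets borel \<Longrightarrow>
      indep_var borel (\<lambda>\<omega>. indicator B (X \<omega>) :: real) borel (\<lambda>\<omega>. h (Z \<omega>) :: real)"
    and fin: "finite R" "X ` space M \<subseteq> R"
  shows "AE \<omega> in M. cond_exp_given M (\<lambda>\<omega>. H (X \<omega>) (Z \<omega>)) X \<omega> = expectation (\<lambda>\<omega>'. H (X \<omega>) (Z \<omega>'))"
proof -
  let ?G = "vimage_algebra (space M) X borel"
  define \<phi> where "\<phi> r = expectation (\<lambda>\<omega>. H r (Z \<omega>))" for r
  have sub: "subalgebra M ?G"
    unfolding subalgebra_def using X by (simp add: measurable_iff_sets)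
  interpret G: finite_measure_subalgebra M ?G by unfold_locales (rule sub)
  have HZ[measurable]: "(\<lambda>\<omega>. H r (Z \<omega>)) \<in> borel_measurable M" for r
    by measurable
  have HZ_int: "integrable M (\<lambda>\<omega>. H r (Z \<omega>))" for r
    by (rule integrable_const_bound[of _ "Max (range (\<lambda>c. \<bar>H r c\<bar>))"]) auto
  have split: "g (X \<omega>) \<omega> = (\<Sum>r\<in>R. indicator {r} (X \<omega>) * g r \<omega>)" if "\<omega> \<in> space M" for g :: "'b \<Rightarrow> 'a \<Rightarrow> real" and \<omega>
    using that fin by (auto simp: indicator_def if_distrib[of "\<lambda>t. t * _"] cong: if_cong)
  have ind_int: "integrable M (\<lambda>\<omega>. indicator (C \<inter> {r}) (X \<omega>) :: real)" if [measurable]: "C \<in> sets borel" for C r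
    by (rule integrable_const_bound[of _ 1]) (auto simp: indicator_def)
  have prod_int: "integrable M (\<lambda>\<omega>. indicator (C \<inter> {r}) (X \<omega>) * H r (Z \<omega>))"
    and prod: "expectation (\<lambda>\<omega>. indicator (C \<inter> {r}) (X \<omega>) * H r (Z \<omega>))
      = expectation (\<lambda>\<omega>. indicator (C \<inter> {r}) (X \<omega>)) * \<phi> r"
    if C[measurable]: "C \<in> sets borel" for C r
  proof -
    have iv: "indep_var borel (\<lambda>\<omega>. indicator (C \<inter> {r}) (X \<omega>) :: real) borel (\<lambda>\<omega>. H r (Z \<omega>))"
      by (rule indep) measurable
    show "integrable M (\<lambda>\<omega>. indicator (C \<inter> {r}) (X \<omega>) * H r (Z \<omega>))"
      by (rule indep_var_integrable[OF iv ind_int[OF C] HZ_int])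
    show "expectation (\<lambda>\<omega>. indicator (C \<inter> {r}) (X \<omega>) * H r (Z \<omega>))
      = expectation (\<lambda>\<omega>. indicator (C \<inter> {r}) (X \<omega>)) * \<phi> r"
      unfolding \<phi>_def by (rule indep_var_lebesgue_integral[OF iv ind_int[OF C] HZ_int])
  qed
  have "AE \<omega> in M. real_cond_exp M ?G (\<lambda>\<omega>. H (X \<omega>) (Z \<omega>)) \<omega> = \<phi> (X \<omega>)"
  proof (rule G.real_cond_exp_charact)
    fix S assume "S \<in> sets ?G"
    then obtain C where C: "C \<in> sets borel" and S: "S = X -` C \<inter> space M"
      by (auto simp: sets_vimage_algebra2)
    have ind_split: "indicator S \<omega> *\<^sub>R g (X \<omega>) \<omega> = (\<Sum>r\<in>R. indicator (C \<inter> {r}) (X \<omega>) * g r \<omega>)"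
      if "\<omega> \<in> space M" for g :: "'b \<Rightarrow> 'a \<Rightarrow> real" and \<omega>
      using split[OF that, of g] that by (auto simp: S indicator_def)
    have "(LINT \<omega>:S|M. H (X \<omega>) (Z \<omega>)) = (LINT \<omega>|M. (\<Sum>r\<in>R. indicator (C \<inter> {r}) (X \<omega>) * H r (Z \<omega>)))"
      unfolding set_lebesgue_integral_def

      by (rule Bochner_Integration.integral_cong[OF refl ind_split[of _ "\<lambda>r \<omega>. H r (Z \<omega>)"]])
    also have "\<dots> = (\<Sum>r\<in>R. expectation (\<lambda>\<omega>. indicator (C \<inter> {r}) (X \<omega>)) * \<phi> r)"
      by (subst Bochner_Integration.integral_sum[OF prod_int[OF C]]) (simp only: prod[OF C])
    also have "\<dots> = (LINT \<omega>|M. (\<Sum>r\<in>R. indicator (C \<inter> {r}) (X \<omega>) * \<phi> r))"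
      using ind_int[OF C] by simp
    also have "\<dots> = (LINT \<omega>:S|M. \<phi> (X \<omega>))"
      unfolding set_lebesgue_integral_def
      by (rule Bochner_Integration.integral_cong[OF refl ind_split[of _ "\<lambda>r \<omega>. \<phi> r", symmetric]])
    finally show "(LINT \<omega>:S|M. H (X \<omega>) (Z \<omega>)) = (LINT \<omega>:S|M. \<phi> (X \<omega>))" .
  next
    have "integrable M (\<lambda>\<omega>. \<Sum>r\<in>R. indicator {r} (X \<omega>) * H r (Z \<omega>))"
      using prod_int[of UNIV] by (intro Bochner_Integration.integrable_sum) simp
    then show "integrable M (\<lambda>\<omega>. H (X \<omega>) (Z \<omega>))"
      by (subst Bochner_Integration.integrable_cong[OF refl split[of _ "\<lambda>r \<omega>. H r (Z \<omega>)"]])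
  next
    have "integrable M (\<lambda>\<omega>. \<Sum>r\<in>R. indicator {r} (X \<omega>) * \<phi> r)"
      using ind_int[of UNIV] by (intro Bochner_Integration.integrable_sum integrable_mult_left) simp
    then show "integrable M (\<lambda>\<omega>. \<phi> (X \<omega>))"
      by (subst Bochner_Integration.integrable_cong[OF refl split[of _ "\<lambda>r \<omega>. \<phi> r"]])
  next
    have [measurable]: "X \<in> measurable ?G borel"
      by (rule measurable_vimage_algebra1) simp
    have "(\<lambda>\<omega>. \<Sum>r\<in>R. indicator {r} (X \<omega>) * \<phi> r) \<in> borel_measurable ?G"
      by measurable
    then show "(\<lambda>\<omega>. \<phi> (X \<omega>)) \<in> borel_measurable ?G"
      by (rule measurable_cong[THEN iffD2, rotated]) (use split[of _ "\<lambda>r \<omega>. \<phi> r"] in simp)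
  qed
  then show ?thesis by (simp add: cond_exp_given_def \<phi>_def)
qed

text \<open>
  The iterate is a function of the past draws only; independence of the next draw and
  measurability both come from this.
\<close>

lemma cd_iterate_cong:
  assumes "\<And>m. m < k \<Longrightarrow> l m = l' m"
  shows "cd_iterate F s x0 l k = cd_iterate F s x0 l' k"
  using assms by (induction k) (simp_all add: Let_def)

lemma finite_range_cd_iterate:
  fixes F :: "real ^ 'e::finite \<Rightarrow> real"
  shows "finite (range (\<lambda>l. cd_iterate F s x0 l k))"
proof (induction k)
  case (Suc k)
  let ?step = "\<lambda>(x, e). x - (s * partial_deriv F e x) *\<^sub>R axis e 1"
  have sub: "range (\<lambda>l. cd_iterate F s x0 l (Suc k)) \<subseteq> ?step ` (range (\<lambda>l. cd_iterate F s x0 l k) \<times> UNIV)"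
    by (auto simp: Let_def image_iff)
  show ?case by (rule finite_subset[OF sub]) (simp add: Suc)
qed simp

text \<open>
  Past and next draw are compared as points of product spaces over \<open>{..<k}\<close> and \<open>{k}\<close>. These are finite
  products of discrete spaces, hence discrete, so every function of the draws is measurable.
\<close>

lemma (in prob_space) indep_var_cd_iterate_next_edge:
  fixes F :: "real ^ 'e::finite \<Rightarrow> real" and node :: "nat \<Rightarrow> 'a \<Rightarrow> 'v::finite"
    and a :: "real ^ 'e \<Rightarrow> real" and b :: "'e \<Rightarrow> real"
  assumes "indep_vars (\<lambda>_. count_space UNIV) (\<lambda>k \<omega>. (node k \<omega>, edge k \<omega>)) UNIV"
  shows "indep_var borel (\<lambda>\<omega>. a (cd_iterate F s x0 (\<lambda>m. edge m \<omega>) k)) borel (\<lambda>\<omega>. b (edge k \<omega>))"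
proof -
  let ?D = "\<lambda>\<omega> j. (node j \<omega>, edge j \<omega>)"
  have PiM: "PiM J (\<lambda>_. count_space (UNIV :: ('v \<times> 'e) set)) = count_space (J \<rightarrow>\<^sub>E UNIV)"
    if "finite J" for J :: "nat set"
    by (rule count_space_PiM_finite[OF that]) (simp add: countable_finite)
  have "indep_var (PiM {..<k} (\<lambda>_. count_space UNIV)) (\<lambda>\<omega>. restrict (?D \<omega>) {..<k})
      (PiM {k} (\<lambda>_. count_space UNIV)) (\<lambda>\<omega>. restrict (?D \<omega>) {k})"
    by (rule indep_var_restrict[OF assms]) auto
  then have "indep_var borel ((\<lambda>z. a (cd_iterate F s x0 (\<lambda>m. snd (z m)) k)) \<circ> (\<lambda>\<omega>. restrict (?D \<omega>) {..<k}))
      borel ((\<lambda>z. b (snd (z k))) \<circ> (\<lambda>\<omega>. restrict (?D \<omega>) {k}))"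
    by (rule indep_var_compose) (simp_all add: PiM)
  moreover have "cd_iterate F s x0 (\<lambda>m. snd (restrict (?D \<omega>) {..<k} m)) k
      = cd_iterate F s x0 (\<lambda>m. edge m \<omega>) k" for \<omega>
    by (rule cd_iterate_cong) simp
  ultimately show ?thesis by (simp add: comp_def)
qed

lemma measurable_cd_iterate:
  fixes F :: "real ^ 'e::finite \<Rightarrow> real"
  assumes "\<And>j. edge j \<in> measurable M (count_space UNIV)"
  shows "(\<lambda>\<omega>. cd_iterate F s x0 (\<lambda>m. edge m \<omega>) k) \<in> borel_measurable M"
proof -
  have [measurable]: "(\<lambda>\<omega>. \<lambda>m\<in>{..<k}. edge m \<omega>) \<in> measurable M (PiM {..<k} (\<lambda>_. count_space UNIV))"
    using assms by (intro measurable_restrict)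
  have "PiM {..<k} (\<lambda>_. count_space (UNIV :: 'e set)) = count_space ({..<k} \<rightarrow>\<^sub>E UNIV)"
    by (rule count_space_PiM_finite) (simp_all add: countable_finite)
  then have "(\<lambda>z. cd_iterate F s x0 z k) \<in> borel_measurable (PiM {..<k} (\<lambda>_. count_space (UNIV :: 'e set)))"
    by simp
  then have "(\<lambda>\<omega>. cd_iterate F s x0 (\<lambda>m\<in>{..<k}. edge m \<omega>) k) \<in> borel_measurable M"
    by measurable
  moreover have "cd_iterate F s x0 (\<lambda>m\<in>{..<k}. edge m \<omega>) k = cd_iterate F s x0 (\<lambda>m. edge m \<omega>) k" for \<omega>
    by (rule cd_iterate_cong) simp
  ultimately show ?thesis by simp
qed

section \<open>Contraction of the dual objective\<close>

text \<open>
  This makes \<open>gamma_max A\<close> positive, hence the step size \<open>1 / L\<close> meaningful, and shows \<open>A \<noteq> 0\<close>.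
\<close>

lemma incidence_matrix_column:
  fixes A :: "real ^ 'e::finite ^ 'v::finite"
  assumes "incidence_matrix ends A"
  shows "(norm (A *v axis l 1))\<^sup>2 = 2"
proof -
  obtain i j where ij: "i \<noteq> j" "A $ i $ l = 1" "A $ j $ l = -1"
    and rest: "\<And>h. h \<noteq> i \<Longrightarrow> h \<noteq> j \<Longrightarrow> A $ h $ l = 0"
    using assms unfolding incidence_matrix_def by metis
  have "(norm (A *v axis l 1))\<^sup>2 = (\<Sum>h\<in>UNIV. (A $ h $ l)\<^sup>2)"
    unfolding power2_norm_eq_inner
    by (simp add: inner_vec_def matrix_vector_mult_basis column_def power2_eq_square)
  also have "\<dots> = (\<Sum>h\<in>{i, j}. (A $ h $ l)\<^sup>2)"
    by (rule sum.mono_neutral_right) (auto simp: rest)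
  also have "\<dots> = 2" using ij by simp
  finally show ?thesis .
qed

lemma gamma_max_incidence_pos:
  fixes A :: "real ^ 'e::finite ^ 'v::finite"
  assumes "incidence_matrix ends A"
  shows "gamma_max A > 0"
  using norm_mult_le_gamma_max[of A "axis undefined 1"] incidence_matrix_column[OF assms]
  by simp

lemma dual_objective_separable:
  "dual_objective f A = (\<lambda>x. \<Sum>i\<in>UNIV. fenchel_conjugate (f i) ((A *v x) $ i))"
  by (simp add: fun_eq_iff dual_objective_def inner_axis')

text \<open>
  The deterministic heart of the result: one step from a fixed point \<open>x\<close>, averaged over the draw, compared
  with an arbitrary reference point \<open>y\<close>.
\<close>

lemma setwise_uniform_step_contraction:
  fixes ends :: "'e::finite \<Rightarrow> 'v::finite set" and A :: "real ^ 'e ^ 'v"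
  assumes graph: "simple_graph ends" "no_isolated_node ends"
    and incidence: "incidence_matrix ends A"
    and diff: "\<And>i x. f i differentiable (at x)"
    and bounds: "\<And>i. 0 < \<mu> i" "\<And>i. \<mu> i \<le> M i"
    and curvature: "\<And>i. curvature_bounds (f i) (\<mu> i) (M i)"
  defines "F \<equiv> dual_objective f A"
    and "L \<equiv> smoothness_const A \<mu>"
    and "\<sigma> \<equiv> strong_convexity_const A M"
  shows "measure_pmf.expectation (setwise_uniform_pmf ends)
      (\<lambda>z. F (x - (1 / L * partial_deriv F (snd z) x) *\<^sub>R axis (snd z) 1)) - F y
    \<le> (1 - 2 * \<sigma> / (L * real CARD('v) * real (max_degree ends))) * (F x - F y)"
proof -
  define \<mu>' M' where "\<mu>' = Min (range \<mu>)" and "M' = Max (range M)"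
  have "\<mu>' > 0" using bounds(1) by (simp add: \<mu>'_def)
  have "M i > 0" for i using bounds less_le_trans by blast
  then have "M' > 0" by (simp add: M'_def Max_gr_iff)
  have "L > 0" using gamma_max_incidence_pos[OF incidence] \<open>\<mu>' > 0\<close>
    by (simp add: L_def smoothness_const_def \<mu>'_def)
  have "A \<noteq> 0" using incidence_matrix_column[OF incidence] by (metis matrix_vector_mult_0 norm_zero zero_neq_numeral zero_power2)
  define p where "p = transpose A *v (\<chi> i. deriv (fenchel_conjugate (f i)) ((A *v x) $ i))"
  have F_eq: "F x = (\<Sum>i\<in>UNIV. fenchel_conjugate (f i) ((A *v x) $ i))" for x
    by (simp add: F_def dual_objective_separable)
  note conj = fenchel_conjugate_curvature[OF curvature bounds diff]
  have "1 / M' \<le> 1 / M i" "1 / \<mu> i \<le> 1 / \<mu>'" for i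
    using bounds(1) \<open>M i > 0\<close> \<open>M' > 0\<close> \<open>\<mu>' > 0\<close> by (auto intro!: divide_left_mono simp: \<mu>'_def M'_def)
  note quad = curvature_bounds_separable[where h = "\<lambda>i. fenchel_conjugate (f i)" and A = A and x = x,
      OF conj(1) this, folded p_def F_eq]
  have grad: "p $ l = partial_deriv F l x" for l
    unfolding F_def dual_objective_separable p_def using conj(2) by (subst partial_deriv_separable) auto
  have smooth: "F (x + d) \<le> F x + p \<bullet> d + L / 2 * (norm d)\<^sup>2" for d
  proof -
    have "1 / \<mu>' / 2 * (norm (A *v d))\<^sup>2 \<le> 1 / \<mu>' / 2 * (gamma_max A * (norm d)\<^sup>2)"
      using \<open>\<mu>' > 0\<close> by (intro mult_left_mono norm_mult_le_gamma_max) auto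
    also have "\<dots> = L / 2 * (norm d)\<^sup>2" by (simp add: L_def smoothness_const_def \<mu>'_def)
    finally show ?thesis using quad(2)[of d] by linarith
  qed
  have dominance: "2 * \<sigma> * (F x - F y) \<le> (norm p)\<^sup>2"
    using gradient_dominance[OF \<open>A \<noteq> 0\<close> \<open>M' > 0\<close> quad(1)[unfolded p_def], of "y - x"]
    by (simp add: p_def \<sigma>_def strong_convexity_const_def M'_def)
  let ?next = "\<lambda>l. F (x - (1 / L * partial_deriv F l x) *\<^sub>R axis l 1)"
  let ?E = "measure_pmf.expectation (setwise_uniform_pmf ends)"
  have int: "integrable (setwise_uniform_pmf ends) g" for g :: "'v \<times> 'e \<Rightarrow> real"
    by (rule integrable_measure_pmf_finite) simp
  have "?E (\<lambda>z. ?next (snd z)) \<le> ?E (\<lambda>z. F x - (p $ snd z)\<^sup>2 / (2 * L))"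
    by (intro integral_mono int coordinate_step_decrease \<open>L > 0\<close> grad smooth)
  also have "\<dots> = F x - ?E (\<lambda>z. (p $ snd z)\<^sup>2) / (2 * L)"
    using int by simp
  \<comment> \<open>The factor 2 from double counting cancels the 2 in the decrease \<open>(p $ l)\<^sup>2 / (2 * L)\<close>.\<close>
  also have "\<dots> \<le> F x - 2 / (real CARD('v) * real (max_degree ends)) * (norm p)\<^sup>2 / (2 * L)"
  proof -
    have "(norm p)\<^sup>2 = (\<Sum>l\<in>UNIV. (p $ l)\<^sup>2)"
      unfolding power2_norm_eq_inner by (simp add: inner_vec_def power2_eq_square)
    then show ?thesis
      using setwise_uniform_expectation_ge[OF graph, of "\<lambda>l. (p $ l)\<^sup>2"] \<open>L > 0\<close>
      by (intro diff_left_mono divide_right_mono) auto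
  qed
  also have "\<dots> = F x - 1 / (L * real CARD('v) * real (max_degree ends)) * (norm p)\<^sup>2"
    by simp
  also have "\<dots> \<le> F x - 1 / (L * real CARD('v) * real (max_degree ends)) * (2 * \<sigma> * (F x - F y))"
    using \<open>L > 0\<close> by (intro diff_left_mono mult_left_mono dominance) auto
  finally show ?thesis by (simp add: algebra_simps diff_divide_distrib)
qed

theorem theorem1:
  fixes ends :: "'e::finite \<Rightarrow> 'v::finite set"
    and A :: "real ^ 'e ^ 'v"
    and f :: "'v \<Rightarrow> real \<Rightarrow> real"
    and \<mu> M :: "'v \<Rightarrow> real"
    and xstar x0 :: "real ^ 'e"
    and P :: "'w measure"
    and node :: "nat \<Rightarrow> 'w \<Rightarrow> 'v"
    and edge :: "nat \<Rightarrow> 'w \<Rightarrow> 'e"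
    and k :: nat
  assumes graph: "simple_graph ends" "no_isolated_node ends"
    and incidence: "incidence_matrix ends A"
    and diff: "\<And>i x. f i differentiable (at x)"
    and bounds: "\<And>i. 0 < \<mu> i" "\<And>i. \<mu> i \<le> M i"
    and curvature: "\<And>i. curvature_bounds (f i) (\<mu> i) (M i)"
    and minimizer: "\<And>x. dual_objective f A xstar \<le> dual_objective f A x"
    and draws: "setwise_uniform_draws P ends node edge"
  defines "F \<equiv> dual_objective f A"
    and "L \<equiv> smoothness_const A \<mu>"
    and "\<sigma> \<equiv> strong_convexity_const A M"
  defines "X \<equiv> (\<lambda>j \<omega>. cd_iterate F (1 / L) x0 (\<lambda>m. edge m \<omega>) j)"
  shows "AE \<omega> in P.
    cond_exp_given P (\<lambda>\<omega>'. F (X (Suc k) \<omega>')) (X k) \<omega> - F xstar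
      \<le> (1 - 2 * \<sigma> / (L * real CARD('v) * real (max_degree ends))) * (F (X k \<omega>) - F xstar)"
proof -
  interpret prob_space P using draws by (simp add: setwise_uniform_draws_def)
  have indep: "indep_vars (\<lambda>_. count_space UNIV) (\<lambda>k \<omega>. (node k \<omega>, edge k \<omega>)) UNIV"
    and law: "distr P (count_space UNIV) (\<lambda>\<omega>. (node k \<omega>, edge k \<omega>)) = setwise_uniform_pmf ends" for k
    using draws by (auto simp: setwise_uniform_draws_def)
  have draw[measurable]: "(\<lambda>\<omega>. (node j \<omega>, edge j \<omega>)) \<in> measurable P (count_space UNIV)" for j
    using indep by (simp add: indep_vars_def)
  have "(\<lambda>\<omega>. snd (node j \<omega>, edge j \<omega>)) \<in> measurable P (count_space UNIV)" for j
    by (rule measurable_compose[OF draw]) simp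
  then have edge[measurable]: "edge j \<in> measurable P (count_space UNIV)" for j
    by simp
  define H where "H x l = F (x - (1 / L * partial_deriv F l x) *\<^sub>R axis l 1)" for x l
  have "AE \<omega> in P. cond_exp_given P (\<lambda>\<omega>. H (X k \<omega>) (edge k \<omega>)) (X k) \<omega>
      = expectation (\<lambda>\<omega>'. H (X k \<omega>) (edge k \<omega>'))"
  proof (rule cond_exp_given_independent_finite)
    show "finite (range (\<lambda>l. cd_iterate F (1 / L) x0 l k))"
      by (rule finite_range_cd_iterate)
    show "X k \<in> borel_measurable P"
      unfolding X_def by (rule measurable_cd_iterate[OF edge])
    show "indep_var borel (\<lambda>\<omega>. indicator B (X k \<omega>) :: real) borel (\<lambda>\<omega>. h (edge k \<omega>) :: real)" for B h
      unfolding X_def by (rule indep_var_cd_iterate_next_edge[OF indep])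
  qed (auto simp: X_def)
  moreover have "expectation (\<lambda>\<omega>'. H x (edge k \<omega>'))
      = measure_pmf.expectation (setwise_uniform_pmf ends) (\<lambda>z. H x (snd z))" for x
    unfolding law[of k, symmetric] by (subst integral_distr[OF draw]) auto
  ultimately have "AE \<omega> in P. cond_exp_given P (\<lambda>\<omega>. H (X k \<omega>) (edge k \<omega>)) (X k) \<omega>
      = measure_pmf.expectation (setwise_uniform_pmf ends) (\<lambda>z. H (X k \<omega>) (snd z))"
    by simp
  moreover have "(\<lambda>\<omega>. F (X (Suc k) \<omega>)) = (\<lambda>\<omega>. H (X k \<omega>) (edge k \<omega>))"
    by (simp add: X_def H_def Let_def)
  ultimately show ?thesis
    unfolding H_def
    using setwise_uniform_step_contraction[OF graph incidence diff bounds curvature, where y = xstar]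
    by (auto simp: F_def L_def \<sigma>_def elim!: eventually_mono)
qed

end
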